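(* Let $\mathcal{H}$ be a separable complex Hilbert space. If $T \in B(\mathcal{H})$ is algebraic of degree at most $2$, then $T$ is a complex symmetric operator. Moreover, this is sharp: for each finite integer $n \geq 3$ and each separable complex Hilbert space $\mathcal{H}$ with $\dim \mathcal{H} \geq n$, there exists an algebraic operator on $\mathcal{H}$ of degree $n$ that is not a complex symmetric operator.
   Context: An operator $T\in B(\mathcal{H})$ is algebraic if $p(T)=0$ for some nonzero polynomial $p$; its degree is the least degree of such a polynomial. A conjugation on $\mathcal{H}$ is a conjugate-linear map $C:\mathcal{H}\to\mathcal{H}$ that is isometric and involutive ($C^2=I$). An operator $T$ is complex symmetric if $T = CT^*C$ for some conjugation $C$. *)

theory Defs
  imports "HOL-Analysis.Analysis" "HOL-Computational_Algebra.Polynomial"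
begin

class complex_inner_space = real_normed_vector +
  fixes scaleC :: "complex \<Rightarrow> 'a \<Rightarrow> 'a"
    and cinner :: "'a \<Rightarrow> 'a \<Rightarrow> complex"
  assumes scaleC_add_right: "scaleC a (x + y) = scaleC a x + scaleC a y"
    and scaleC_add_left: "scaleC (a + b) x = scaleC a x + scaleC b x"
    and scaleC_scaleC: "scaleC a (scaleC b x) = scaleC (a * b) x"
    and scaleC_one: "scaleC 1 x = x"
    and scaleR_scaleC: "scaleR r x = scaleC (complex_of_real r) x"
    and cinner_add_left: "cinner (x + y) z = cinner x z + cinner y z"
    and cinner_scaleC_left: "cinner (scaleC a x) y = cnj a * cinner x y"
    and cinner_commute: "cinner y x = cnj (cinner x y)"
    and cinner_norm: "cinner x x = complex_of_real ((norm x)\<^sup>2)"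

class chilbert = complex_inner_space + complete_space

definition separable_space :: "'a::topological_space set \<Rightarrow> bool" where
  "separable_space S \<longleftrightarrow> (\<exists>D. countable D \<and> D \<subseteq> S \<and> S \<subseteq> closure D)"

definition bounded_clinear :: "('a::complex_inner_space \<Rightarrow> 'a) \<Rightarrow> bool" where
  "bounded_clinear T \<longleftrightarrow> bounded_linear T \<and> (\<forall>c x. T (scaleC c x) = scaleC c (T x))"

definition adjoint :: "('a::complex_inner_space \<Rightarrow> 'a) \<Rightarrow> ('a \<Rightarrow> 'a)" where
  "adjoint T = (THE S. \<forall>x y. cinner (T x) y = cinner x (S y))"

definition conjugation :: "('a::complex_inner_space \<Rightarrow> 'a) \<Rightarrow> bool" where
  "conjugation C \<longleftrightarrow>
     (\<forall>x y. C (x + y) = C x + C y) \<and>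
     (\<forall>c x. C (scaleC c x) = scaleC (cnj c) (C x)) \<and>
     (\<forall>x. norm (C x) = norm x) \<and>
     (\<forall>x. C (C x) = x)"

definition complex_symmetric :: "('a::complex_inner_space \<Rightarrow> 'a) \<Rightarrow> bool" where
  "complex_symmetric T \<longleftrightarrow> (\<exists>C. conjugation C \<and> T = C \<circ> adjoint T \<circ> C)"

definition poly_op :: "complex poly \<Rightarrow> ('a::complex_inner_space \<Rightarrow> 'a) \<Rightarrow> ('a \<Rightarrow> 'a)" where
  "poly_op p T = (\<lambda>x. \<Sum>i\<le>degree p. scaleC (coeff p i) ((T ^^ i) x))"

definition algebraic_op :: "('a::complex_inner_space \<Rightarrow> 'a) \<Rightarrow> bool" where
  "algebraic_op T \<longleftrightarrow> (\<exists>p. p \<noteq> 0 \<and> poly_op p T = (\<lambda>_. 0))"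

definition alg_degree :: "('a::complex_inner_space \<Rightarrow> 'a) \<Rightarrow> nat" where
  "alg_degree T = (LEAST n. \<exists>p. p \<noteq> 0 \<and> degree p = n \<and> poly_op p T = (\<lambda>_. 0))"

abbreviation cdependent :: "'a::complex_inner_space set \<Rightarrow> bool" where
  "cdependent S \<equiv> module.dependent scaleC S"

end

theory Submission
  imports Defs
begin

text \<open>
  If \<open>T\<close> has degree at most 2, then \<open>(T - \<lambda>)\<^sup>2 = c\<close> for some scalars, and replacing \<open>T\<close> by \<open>T - \<lambda>\<close>
  we may assume \<open>T\<^sup>2 = c\<close>. A vector \<open>x\<close> spans, under words in \<open>T\<close> and \<open>T\<^sup>*\<close>, a reducing subspace on
  which \<open>w x \<mapsto> w' x\<close> (\<open>w'\<close> exchanges \<open>T\<close> and \<open>T\<^sup>*\<close> in \<open>w\<close>) extends to a conjugation \<open>C\<close> with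
  \<open>C T = T\<^sup>* C\<close>, as soon as \<open>\<langle>x, w x\<rangle>\<close> is invariant under reversal of \<open>w\<close>. Because \<open>T\<^sup>2\<close> is
  scalar, this only concerns the words \<open>(T T\<^sup>*)\<^sup>k\<close>, and a suitable \<open>x\<close> exists in every nonzero
  reducing subspace. By Zorn's lemma there is a maximal partially defined conjugation with
  \<open>C T = T\<^sup>* C\<close>, and it is defined everywhere.

  For sharpness, the weighted shift \<open>e\<^sub>0 \<mapsto> 2 e\<^sub>1\<close>, \<open>e\<^sub>1 \<mapsto> e\<^sub>2\<close>, and so on up to \<open>e\<^sub>n\<^sub>-\<^sub>2 \<mapsto> e\<^sub>n\<^sub>-\<^sub>1 \<mapsto> 0\<close>
  has degree \<open>n\<close>, but its weights are not a palindrome.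
\<close>

section \<open>Complex Hilbert spaces\<close>

interpretation cvec: vector_space "scaleC :: complex \<Rightarrow> 'a \<Rightarrow> 'a::complex_inner_space"
  by unfold_locales (simp_all add: scaleC_add_right scaleC_add_left scaleC_scaleC scaleC_one)

lemma cinner_add_right: "cinner x (y + z) = cinner x y + cinner x z"
  unfolding cinner_commute[where y = x] by (simp add: cinner_add_left)

lemma cinner_scaleC_right: "cinner x (scaleC a y) = a * cinner x y"
  unfolding cinner_commute[where y = x] by (simp add: cinner_scaleC_left)

text \<open>The class gives homogeneity for real scalars only; the complex case is forced by
  \<open>cinner_norm\<close>.\<close>

lemma norm_scaleC: "norm (scaleC a x) = cmod a * norm (x::'a::complex_inner_space)"
proof -
  have "complex_of_real ((norm (scaleC a x))\<^sup>2) = cnj a * a * complex_of_real ((norm x)\<^sup>2)"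
    by (simp add: cinner_norm[symmetric] cinner_scaleC_left cinner_scaleC_right del: of_real_power)
  also have "\<dots> = complex_of_real ((cmod a * norm x)\<^sup>2)"
    by (metis complex_norm_square mult.commute of_real_mult power_mult_distrib)
  finally have "(norm (scaleC a x))\<^sup>2 = (cmod a * norm x)\<^sup>2"
    using of_real_eq_iff by blast
  then show ?thesis by (simp add: power2_eq_iff_nonneg)
qed

lemma cinner_Cauchy_Schwarz: "cmod (cinner x y) \<le> norm x * norm (y::'a::complex_inner_space)"
proof (cases "y = 0")
  case True
  have "cinner x (0::'a) = 0" by (metis cinner_add_right add_cancel_right_right)
  with True show ?thesis by simp
next
  case False
  define N where "N = complex_of_real ((norm y)\<^sup>2)"
  \<comment> \<open>\<open>z\<close> is the component of \<open>x\<close> orthogonal to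
    \<open>y\<close>, multiplied by \<open>N\<close> to avoid a division.\<close>
  define z where "z = scaleC N x + scaleC (- cinner y x) y"
  have yz: "cinner y z = 0"
    by (simp add: z_def cinner_add_right cinner_scaleC_right cinner_norm N_def
        del: cvec.scale_minus_left)
  have "cinner z z = N * cinner x z"
    by (subst z_def) (simp add: cinner_add_left cinner_scaleC_left yz N_def
        del: cvec.scale_minus_left)
  also have "\<dots> = N * (complex_of_real ((norm x)\<^sup>2) * N - cinner x y * cinner y x)"
    by (simp add: z_def cinner_add_right cinner_scaleC_right cinner_norm algebra_simps
        del: cvec.scale_minus_left)
  also have "cinner x y * cinner y x = complex_of_real ((cmod (cinner x y))\<^sup>2)"
    by (metis cinner_commute complex_norm_square)
  finally have "complex_of_real ((norm z)\<^sup>2)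
      = complex_of_real ((norm y)\<^sup>2 * ((norm x)\<^sup>2 * (norm y)\<^sup>2 - (cmod (cinner x y))\<^sup>2))"
    by (simp add: N_def cinner_norm)
  then have "(norm z)\<^sup>2 = (norm y)\<^sup>2 * ((norm x)\<^sup>2 * (norm y)\<^sup>2 - (cmod (cinner x y))\<^sup>2)"
    using of_real_eq_iff by blast
  then have "0 \<le> (norm y)\<^sup>2 * ((norm x)\<^sup>2 * (norm y)\<^sup>2 - (cmod (cinner x y))\<^sup>2)"
    by (metis zero_le_power2)
  then have "(cmod (cinner x y))\<^sup>2 \<le> (norm x * norm y)\<^sup>2"
    using False by (simp add: zero_le_mult_iff power_mult_distrib)
  then show ?thesis by (rule power2_le_imp_le) simp
qed

interpretation cip: bounded_bilinear "cinner :: 'a::complex_inner_space \<Rightarrow> 'a \<Rightarrow> complex"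
proof
  show "\<exists>K. \<forall>a b::'a. norm (cinner a b) \<le> norm a * norm b * K"
    by (rule exI[of _ 1]) (simp add: cinner_Cauchy_Schwarz)
qed (simp_all add: cinner_add_left cinner_add_right scaleR_scaleC cinner_scaleC_left
    cinner_scaleC_right scaleR_conv_of_real)

interpretation csc: bounded_bilinear "scaleC :: complex \<Rightarrow> 'a \<Rightarrow> 'a::complex_inner_space"
proof
  show "\<exists>K. \<forall>a (b::'a). norm (scaleC a b) \<le> norm a * norm b * K"
    by (rule exI[of _ 1]) (simp add: norm_scaleC)
qed (simp_all add: scaleC_add_left scaleC_add_right scaleR_scaleC scaleC_scaleC
    scaleR_conv_of_real mult.commute)

lemma cinner_self_eq_0_iff: "cinner x x = 0 \<longleftrightarrow> x = (0::'a::complex_inner_space)"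
  by (simp add: cinner_norm)

lemma cinner_eqI: "(\<And>x. cinner x y = cinner x z) \<Longrightarrow> y = (z::'a::complex_inner_space)"
proof -
  assume "\<And>x. cinner x y = cinner x z"
  then have "cinner (y - z) (y - z) = 0" unfolding cip.diff_right by simp
  then show ?thesis by (simp add: cinner_self_eq_0_iff)
qed

lemma cinner_eq_0_sym: "cinner x y = 0 \<longleftrightarrow> cinner y x = 0"
  unfolding cinner_commute[where y = x and x = y] by simp

lemma norm_sq_cinner: "(norm x)\<^sup>2 = Re (cinner x x)"
  by (simp add: cinner_norm)

lemma csubspace_imp_subspace: "cvec.subspace M \<Longrightarrow> subspace M"
  by (auto simp: cvec.subspace_def subspace_def scaleR_scaleC)

section \<open>Nearest points, orthogonal vectors and the Riesz representation\<close>

lemma parallelogram_law: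
  "(norm (x + y))\<^sup>2 + (norm (x - y))\<^sup>2 = 2 * (norm x)\<^sup>2 + 2 * (norm (y::'a::complex_inner_space))\<^sup>2"
  by (simp add: norm_sq_cinner cip.add_left cip.add_right cip.diff_left cip.diff_right)

text \<open>A minimizing sequence is Cauchy: midpoints of its members lie in \<open>M\<close>, hence
  at distance at least \<open>d\<close> from \<open>y\<close>, and the parallelogram law then makes
  the members close to each other.\<close>

lemma closest_point_closed_csubspace:
  fixes y :: "'a::chilbert"
  assumes M: "cvec.subspace M" "closed M"
  obtains m where "m \<in> M" "\<And>u. u \<in> M \<Longrightarrow> norm (y - m) \<le> norm (y - u)"
proof -
  define d where "d = infdist y M"
  have ne: "M \<noteq> {}" using cvec.subspace_0[OF M(1)] by auto
  have d0: "d \<ge> 0" by (simp add: d_def infdist_nonneg)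
  have le: "d \<le> norm (y - u)" if "u \<in> M" for u
    using infdist_le[OF that] by (simp add: d_def dist_norm)
  have "\<exists>u\<in>M. norm (y - u) < d + 1 / real (Suc n)" for n
  proof (rule ccontr)
    assume "\<not> ?thesis"
    then have "d + 1 / real (Suc n) \<le> d"
      unfolding d_def infdist_notempty[OF ne] by (intro cINF_greatest) (use ne in \<open>auto simp: dist_norm d_def infdist_def\<close>)
    then show False by (simp add: divide_le_0_iff)
  qed
  then obtain s where sM: "\<And>n. s n \<in> M" and s: "\<And>n. norm (y - s n) < d + 1 / real (Suc n)"
    by metis
  have lim: "(\<lambda>n. norm (y - s n)) \<longlonglongrightarrow> d"
  proof (rule tendsto_sandwich)
    show "\<forall>\<^sub>F n in sequentially. d \<le> norm (y - s n)" using le sM by simp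
    show "\<forall>\<^sub>F n in sequentially. norm (y - s n) \<le> d + 1 / real (Suc n)"
      using s by (intro always_eventually) (auto intro: less_imp_le)
    show "(\<lambda>n. d + 1 / real (Suc n)) \<longlonglongrightarrow> d"
      using tendsto_add[OF tendsto_const LIMSEQ_inverse_real_of_nat, of d] by (simp add: inverse_eq_divide)
  qed simp
  have "Cauchy s"
  proof (rule metric_CauchyI)
    fix e :: real assume "e > 0"
    have "(\<lambda>n. (norm (y - s n))\<^sup>2) \<longlonglongrightarrow> d\<^sup>2" by (intro tendsto_power lim)
    then have "\<forall>\<^sub>F n in sequentially. (norm (y - s n))\<^sup>2 < d\<^sup>2 + e\<^sup>2 / 4"
      using \<open>e > 0\<close> by (intro order_tendstoD) auto
    then obtain N where N: "\<And>n. n \<ge> N \<Longrightarrow> (norm (y - s n))\<^sup>2 < d\<^sup>2 + e\<^sup>2 / 4"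
      by (auto simp: eventually_sequentially)
    have "dist (s i) (s j) < e" if "i \<ge> N" "j \<ge> N" for i j
    proof -
      have "(1/2) *\<^sub>R (s i + s j) \<in> M"
        using csubspace_imp_subspace[OF M(1)] sM by (simp add: subspace_add subspace_scale)
      then have "d \<le> norm (y - (1/2) *\<^sub>R (s i + s j))" by (rule le)
      moreover have "(y - s i) + (y - s j) = 2 *\<^sub>R (y - (1/2) *\<^sub>R (s i + s j))"
        by (simp add: algebra_simps scaleR_2)
      ultimately have "2 * d \<le> norm ((y - s i) + (y - s j))" by simp
      then have "4 * d\<^sup>2 \<le> (norm ((y - s i) + (y - s j)))\<^sup>2"
        using d0 power_mono[of "2 * d" _ 2] by (simp add: power_mult_distrib)
      moreover have "(y - s i) - (y - s j) = s j - s i" by simp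
      ultimately have "(norm (s j - s i))\<^sup>2 < e\<^sup>2"
        using parallelogram_law[of "y - s i" "y - s j"] N[OF that(1)] N[OF that(2)] by simp
      then show ?thesis using \<open>e > 0\<close>
        by (metis dist_commute dist_norm less_imp_le power2_less_imp_less)
    qed
    then show "\<exists>N. \<forall>i\<ge>N. \<forall>j\<ge>N. dist (s i) (s j) < e" by blast
  qed
  then obtain m where m: "s \<longlonglongrightarrow> m" using Cauchy_convergent convergent_def by blast
  have "m \<in> M" using closed_sequentially[OF M(2)] sM m by blast
  moreover have "(\<lambda>n. norm (y - s n)) \<longlonglongrightarrow> norm (y - m)" by (intro tendsto_intros m)
  then have "norm (y - m) = d" using lim LIMSEQ_unique by blast
  ultimately show ?thesis using that le by metis
qed

text \<open>Take the difference \<open>z\<close> between a point outside \<open>M\<close> and its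
  nearest point in \<open>M\<close>: moving the nearest point along \<open>u\<close> cannot shorten
  \<open>z\<close>, which forces orthogonality.\<close>

lemma closed_csubspace_orthogonal_vector:
  fixes M :: "'a::chilbert set"
  assumes M: "cvec.subspace M" "closed M" and "M \<noteq> UNIV"
  obtains z where "z \<noteq> 0" "\<And>u. u \<in> M \<Longrightarrow> cinner u z = 0"
proof -
  obtain y where y: "y \<notin> M" using assms by auto
  obtain m where m: "m \<in> M" "\<And>u. u \<in> M \<Longrightarrow> norm (y - m) \<le> norm (y - u)"
    using closest_point_closed_csubspace[OF M] by blast
  define z where "z = y - m"
  have "z \<noteq> 0" using y m(1) by (auto simp: z_def)
  moreover have "cinner u z = 0" if u: "u \<in> M" for u
  proof -
    define a where "a = cinner u z"
    \<comment> \<open>The optimal factor would be \<open>1 / (norm u)\<^sup>2\<close>; the added 1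
      covers \<open>u = 0\<close> and still keeps \<open>s * (norm u)\<^sup>2\<close> at most
      1.\<close>
    define s where "s = 1 / ((norm u)\<^sup>2 + 1)"
    have s: "s > 0" "s * (norm u)\<^sup>2 \<le> 1"
      using zero_le_power2[of "norm u"] by (auto simp: s_def add_nonneg_pos divide_le_eq)
    define t where "t = complex_of_real s * a"
    have "m + scaleC t u \<in> M" using M(1) m(1) u by (simp add: cvec.subspace_add cvec.subspace_scale)
    from m(2)[OF this] have "norm z \<le> norm (z - scaleC t u)" by (simp add: z_def algebra_simps)
    then have "(norm z)\<^sup>2 \<le> (norm (z - scaleC t u))\<^sup>2" by (simp add: power_mono)
    also have "\<dots> = Re (cinner z z - t * cnj a - cnj t * a + cnj t * t * cinner u u)"
      unfolding norm_sq_cinner a_def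
      by (simp add: cip.diff_left cip.diff_right cinner_scaleC_left cinner_scaleC_right algebra_simps
          flip: cinner_commute)
    also have "\<dots> = (norm z)\<^sup>2 - 2 * s * (cmod a)\<^sup>2 + s * (s * (norm u)\<^sup>2) * (cmod a)\<^sup>2"
      by (simp add: t_def cinner_norm cmod_power2) (simp add: algebra_simps power2_eq_square)
    finally have "s * (2 * (cmod a)\<^sup>2 - (s * (norm u)\<^sup>2) * (cmod a)\<^sup>2) \<le> 0"
      by (simp add: algebra_simps)
    then have "2 * (cmod a)\<^sup>2 \<le> (s * (norm u)\<^sup>2) * (cmod a)\<^sup>2"
      using s(1) by (simp add: mult_le_0_iff)
    also have "\<dots> \<le> 1 * (cmod a)\<^sup>2" using s(2) by (intro mult_right_mono) auto
    finally show ?thesis by (simp add: a_def)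
  qed
  ultimately show ?thesis using that by blast
qed

lemma Riesz_representation:
  fixes f :: "'a::chilbert \<Rightarrow> complex"
  assumes bl: "bounded_linear f" and sc: "\<And>a x. f (scaleC a x) = a * f x"
  obtains z where "\<And>x. f x = cinner z x"
proof (cases "\<forall>x. f x = 0")
  case True
  then show ?thesis using that[of 0] by (simp add: cip.zero_left)
next
  case False
  interpret f: bounded_linear f by fact
  define M where "M = {x. f x = 0}"
  have "cvec.subspace M" by (auto simp: cvec.subspace_def M_def f.add f.zero sc)
  moreover have "closed M"
    unfolding M_def by (intro closed_Collect_eq f.continuous_on continuous_on_id continuous_on_const)
  moreover have "M \<noteq> UNIV" using False by (auto simp: M_def)
  ultimately obtain w where w: "w \<noteq> 0" "\<And>u. u \<in> M \<Longrightarrow> cinner u w = 0"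
    using closed_csubspace_orthogonal_vector by blast
  \<comment> \<open>\<open>w\<close> is orthogonal to the kernel of \<open>f\<close>, which contains
    \<open>scaleC (f w) x - scaleC (f x) w\<close>; solving for \<open>f x\<close> gives this
    vector.\<close>
  have "f x = cinner (scaleC (cnj (f w) / cinner w w) w) x" for x
  proof -
    have "scaleC (f w) x - scaleC (f x) w \<in> M" by (simp add: M_def f.diff sc)
    then have "cinner w (scaleC (f w) x - scaleC (f x) w) = 0" using w cinner_eq_0_sym by blast
    then have "f w * cinner w x = f x * cinner w w" by (simp add: cip.diff_right cinner_scaleC_right)
    then show ?thesis
      using w(1) by (simp add: cinner_scaleC_left cinner_norm field_simps)
  qed
  then show ?thesis using that by blast
qed

section \<open>Bounded operators and their adjoints\<close>

lemma bounded_clinearD: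
  assumes "bounded_clinear T"
  shows "bounded_linear T" "T (scaleC a x) = scaleC a (T x)" "T (x + y) = T x + T y"
    "T (x - y) = T x - T y" "T 0 = 0"
proof -
  show bl: "bounded_linear T" and "T (scaleC a x) = scaleC a (T x)"
    using assms by (simp_all add: bounded_clinear_def)
  interpret bounded_linear T by (rule bl)
  show "T (x + y) = T x + T y" "T (x - y) = T x - T y" "T 0 = 0"
    by (rule add diff zero)+
qed

lemma adjoint_eqI:
  assumes "\<And>x y. cinner (T x) y = cinner x (S y)"
  shows "Defs.adjoint T = S"
  unfolding Defs.adjoint_def
proof (rule the_equality)
  show "R = S" if "\<forall>x y. cinner (T x) y = cinner x (R y)" for R
  proof
    show "R y = S y" for y by (rule cinner_eqI) (metis that assms)
  qed
qed (intro allI assms)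

text \<open>The description in \<open>adjoint\<close> is meaningful only once an adjoint exists.
  Riesz supplies it, applied to \<open>cinner y (T x)\<close>, which unlike
  \<open>cinner (T x) y\<close> is linear in \<open>x\<close>.\<close>

lemma cinner_adjoint:
  fixes T :: "'a::chilbert \<Rightarrow> 'a"
  assumes T: "bounded_clinear T"
  shows "cinner (T x) y = cinner x (Defs.adjoint T y)"
proof -
  have "\<exists>z. \<forall>x. cinner (T x) y = cinner x z" for y
  proof -
    have "bounded_linear (\<lambda>x. cinner y (T x))"
      using bounded_linear_compose[of "cinner y" T] cip.bounded_linear_right bounded_clinearD(1)[OF T]
      by blast
    then obtain z where "\<And>x. cinner y (T x) = cinner z x"
      using Riesz_representation[of "\<lambda>x. cinner y (T x)"]
      by (auto simp: bounded_clinearD(2)[OF T] cinner_scaleC_right)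
    then show ?thesis by (metis cinner_commute)
  qed
  then obtain S where S: "\<And>x y. cinner (T x) y = cinner x (S y)" by metis
  show ?thesis by (simp add: adjoint_eqI[of T, OF S] S)
qed

lemma bounded_clinear_adjoint:
  fixes T :: "'a::chilbert \<Rightarrow> 'a"
  assumes T: "bounded_clinear T"
  shows "bounded_clinear (Defs.adjoint T)"
proof -
  let ?S = "Defs.adjoint T"
  note adj = cinner_adjoint[OF T]
  have add: "?S (x + y) = ?S x + ?S y" for x y
    by (rule cinner_eqI) (simp add: cip.add_right flip: adj)
  have sc: "?S (scaleC a x) = scaleC a (?S x)" for a x
    by (rule cinner_eqI) (simp add: cinner_scaleC_right flip: adj)
  obtain K where K: "K \<ge> 0" "\<And>x. norm (T x) \<le> norm x * K"
    using bounded_linear.nonneg_bounded[OF bounded_clinearD(1)[OF T]] by blast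
  have "norm (?S y) \<le> norm y * K" for y
  proof -
    have "(norm (?S y))\<^sup>2 = Re (cinner (T (?S y)) y)" by (simp add: adj cinner_norm)
    also have "\<dots> \<le> cmod (cinner (T (?S y)) y)" by (rule complex_Re_le_cmod)
    also have "\<dots> \<le> norm (T (?S y)) * norm y" by (rule cinner_Cauchy_Schwarz)
    also have "\<dots> \<le> norm (?S y) * K * norm y" by (intro mult_right_mono K) simp
    finally have "norm (?S y) * norm (?S y) \<le> norm (?S y) * (norm y * K)"
      by (simp add: power2_eq_square algebra_simps)
    then show ?thesis
      using K(1) by (cases "?S y = 0") (auto simp: mult_le_cancel_left_pos)
  qed
  then have "bounded_linear ?S"
    by (intro bounded_linear_intro[where K = K]) (simp_all add: add sc scaleR_scaleC)
  then show ?thesis by (simp add: bounded_clinear_def sc)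
qed

section \<open>A self-adjoint square root\<close>

text \<open>The iteration for \<open>Y = (A + Y\<^sup>2) / 2\<close>, whose fixed points satisfy \<open>(1 - Y)\<^sup>2 = 1 - A\<close>.\<close>

primrec sqrt_iter :: "('a \<Rightarrow> 'a) \<Rightarrow> nat \<Rightarrow> 'a \<Rightarrow> 'a::real_vector" where
  "sqrt_iter A 0 = (\<lambda>x. 0)"
| "sqrt_iter A (Suc n) = (\<lambda>x. (1/2) *\<^sub>R (A x + sqrt_iter A n (sqrt_iter A n x)))"

text \<open>The iteration with the number 1 in place of \<open>A\<close>, used as a majorant: its
  terms bound the norms of the iterates, its increments those of their differences.\<close>

primrec sqrt_iter_real :: "nat \<Rightarrow> real" where
  "sqrt_iter_real 0 = 0"
| "sqrt_iter_real (Suc n) = (1 + (sqrt_iter_real n)\<^sup>2) / 2"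

lemma sqrt_iter_real_bounds: "0 \<le> sqrt_iter_real n" "sqrt_iter_real n \<le> 1"
proof -
  have "0 \<le> sqrt_iter_real n \<and> sqrt_iter_real n \<le> 1"
    by (induction n) (auto simp: power_le_one)
  then show "0 \<le> sqrt_iter_real n" "sqrt_iter_real n \<le> 1" by auto
qed

lemma sqrt_iter_real_Suc_ge: "sqrt_iter_real n \<le> sqrt_iter_real (Suc n)"
proof -
  have "0 \<le> (1 - sqrt_iter_real n)\<^sup>2" by simp
  then show ?thesis by (simp add: power2_diff)
qed

lemma convergent_sqrt_iter_real: "convergent sqrt_iter_real"
  by (intro Bseq_mono_convergent BseqI'[where K = 1] mono_SucI1)
    (use sqrt_iter_real_bounds sqrt_iter_real_Suc_ge incseq_SucI[of sqrt_iter_real] in \<open>auto simp: incseq_def\<close>)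

lemma sqrt_iter_commute:
  assumes B: "linear B" and BA: "\<And>x. B (A x) = A (B x)"
  shows "B (sqrt_iter A n x) = sqrt_iter A n (B x)"
  by (induction n arbitrary: x) (simp_all add: linear_0[OF B] linear_add[OF B] linear_scale[OF B] BA)

context
  fixes A :: "'a::{real_normed_vector, complete_space} \<Rightarrow> 'a"
  assumes A: "linear A" and norm_A: "\<And>x. norm (A x) \<le> norm x"
begin

lemma linear_sqrt_iter: "linear (sqrt_iter A n)"
  by (induction n)
    (auto intro!: linearI simp: linear_add linear_scale linear_add[OF A] linear_scale[OF A] algebra_simps)

lemma sqrt_iter_self_commute: "sqrt_iter A m (sqrt_iter A n x) = sqrt_iter A n (sqrt_iter A m x)"
  by (intro sqrt_iter_commute linear_sqrt_iter sqrt_iter_commute[OF A, symmetric]) simp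

lemma norm_sqrt_iter: "norm (sqrt_iter A n x) \<le> sqrt_iter_real n * norm x"
proof (induction n arbitrary: x)
  case (Suc n)
  have "norm (sqrt_iter A n (sqrt_iter A n x)) \<le> sqrt_iter_real n * (sqrt_iter_real n * norm x)"
    using Suc by (meson mult_left_mono order_trans sqrt_iter_real_bounds(1))
  then have "norm (A x + sqrt_iter A n (sqrt_iter A n x)) \<le> norm x + (sqrt_iter_real n)\<^sup>2 * norm x"
    by (intro norm_triangle_le add_mono norm_A) (simp add: power2_eq_square)
  then show ?case by (simp add: algebra_simps del: scaleR_add_right)
qed simp

text \<open>The iterates commute, so the difference of two consecutive squares factors into
  difference times sum; the scalar iteration has the same factorization, so the bound reproduces
  itself.\<close>

lemma norm_sqrt_iter_diff:
  "norm (sqrt_iter A (Suc n) x - sqrt_iter A n x) \<le> (sqrt_iter_real (Suc n) - sqrt_iter_real n) * norm x"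
proof (induction n arbitrary: x)
  case 0
  then show ?case using norm_A[of x] by simp
next
  case (Suc n)
  let ?Y = "sqrt_iter A" and ?y = sqrt_iter_real
  let ?u = "?Y (Suc n) x + ?Y n x"
  have step: "?Y (Suc n) x = (1/2) *\<^sub>R (A x + ?Y n (?Y n x))" by simp
  have "?Y (Suc (Suc n)) x - ?Y (Suc n) x
      = (1/2) *\<^sub>R (?Y (Suc n) (?Y (Suc n) x) - ?Y n (?Y n x))"
    by (rule trans[OF arg_cong2[OF fun_cong[OF sqrt_iter.simps(2)] step, of "(-)"]])
      (simp add: algebra_simps del: sqrt_iter.simps)
  also have "?Y (Suc n) (?Y (Suc n) x) - ?Y n (?Y n x) = ?Y (Suc n) ?u - ?Y n ?u"
    unfolding linear_add[OF linear_sqrt_iter] sqrt_iter_self_commute[of "Suc n" n] by simp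
  finally have "norm (?Y (Suc (Suc n)) x - ?Y (Suc n) x) = (1/2) * norm (?Y (Suc n) ?u - ?Y n ?u)"
    by simp
  also have "\<dots> \<le> (1/2) * ((?y (Suc n) - ?y n) * norm ?u)"
    using Suc by (intro mult_left_mono) auto
  also have "\<dots> \<le> (1/2) * ((?y (Suc n) - ?y n) * (?y (Suc n) * norm x + ?y n * norm x))"
    using sqrt_iter_real_Suc_ge[of n]
    by (intro mult_left_mono norm_triangle_le add_mono norm_sqrt_iter) auto
  also have "\<dots> = (1/2) * ((?y (Suc n))\<^sup>2 - (?y n)\<^sup>2) * norm x"
    by (simp only: power2_eq_square) algebra
  also have "(1/2) * ((?y (Suc n))\<^sup>2 - (?y n)\<^sup>2) = ?y (Suc (Suc n)) - ?y (Suc n)"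
    by (simp add: field_simps)
  finally show ?case .
qed

text \<open>Telescoping the increment bounds makes the iterates Cauchy along with the convergent
  scalar sequence.\<close>

lemma convergent_sqrt_iter: "convergent (\<lambda>n. sqrt_iter A n x)"
proof -
  let ?y = "\<lambda>n. sqrt_iter_real n * norm x"
  have le: "norm (sqrt_iter A n x - sqrt_iter A m x) \<le> ?y n - ?y m" if "m \<le> n" for m n
    using that
  proof (induction n rule: dec_induct)
    case (step n)
    then show ?case
      using norm_triangle_ineq[of "sqrt_iter A (Suc n) x - sqrt_iter A n x" "sqrt_iter A n x - sqrt_iter A m x"]
        norm_sqrt_iter_diff[of n x]
      by (simp del: sqrt_iter.simps sqrt_iter_real.simps add: left_diff_distrib)
  qed simp
  have "Cauchy ?y"
    using convergent_sqrt_iter_real by (intro convergent_Cauchy convergent_mult convergent_const)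
  have "Cauchy (\<lambda>n. sqrt_iter A n x)"
  proof (rule metric_CauchyI)
    fix e :: real assume "e > 0"
    then obtain N where N: "\<And>m n. m \<ge> N \<Longrightarrow> n \<ge> N \<Longrightarrow> dist (?y m) (?y n) < e"
      using \<open>Cauchy ?y\<close> by (meson Cauchy_def)
    have "dist (sqrt_iter A m x) (sqrt_iter A n x) < e" if "m \<ge> N" "n \<ge> N" for m n
    proof (cases "m \<le> n")
      case True
      then show ?thesis using le[OF True] N[OF that]
        by (simp add: dist_norm norm_minus_commute[of "sqrt_iter A m x"])
    next
      case False
      then show ?thesis using le[of n m] N[OF that] by (simp add: dist_norm)
    qed
    then show "\<exists>N. \<forall>m\<ge>N. \<forall>n\<ge>N. dist (sqrt_iter A m x) (sqrt_iter A n x) < e" by blast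
  qed
  then show ?thesis by (rule Cauchy_convergent)
qed

end

text \<open>For \<open>A = 1 - s\<^sup>2\<close> the limit \<open>Z\<close> satisfies
  \<open>Z = (A + Z\<^sup>2) / 2\<close>, so \<open>g = 1 - Z\<close> squares to
  \<open>s\<^sup>2\<close>. Self-adjointness, commutation and invariance hold for each iterate and
  pass to the limit.\<close>

lemma self_adjoint_sqrt_of_square:
  fixes s :: "'a::chilbert \<Rightarrow> 'a"
  assumes s: "linear s" and norm_s: "\<And>x. norm (s x) \<le> norm x"
    and sa: "\<And>x y. cinner (s x) y = cinner x (s y)"
  obtains g where "linear g" "\<And>x y. cinner (g x) y = cinner x (g y)" "\<And>x. g (g x) = s (s x)"
    "\<And>B x. bounded_linear B \<Longrightarrow> (\<And>x. B (s (s x)) = s (s (B x))) \<Longrightarrow> B (g x) = g (B x)"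
    "\<And>K x. subspace K \<Longrightarrow> closed K \<Longrightarrow> (\<And>x. x \<in> K \<Longrightarrow> s x \<in> K) \<Longrightarrow> x \<in> K \<Longrightarrow> g x \<in> K"
proof -
  define A where "A = (\<lambda>x. x - s (s x))"
  have A: "linear A"
    by (auto intro!: linearI simp: A_def linear_add[OF s] linear_scale[OF s] algebra_simps)
  \<comment> \<open>Expanding the square, \<open>- 2 * (norm (s x))\<^sup>2\<close> outweighs
    \<open>(norm (s (s x)))\<^sup>2\<close> because \<open>s\<close> is a contraction.\<close>
  have norm_A: "norm (A x) \<le> norm x" for x
  proof -
    have "(norm (A x))\<^sup>2 = (norm x)\<^sup>2 - 2 * (norm (s x))\<^sup>2 + (norm (s (s x)))\<^sup>2"
      unfolding norm_sq_cinner A_def cip.diff_left cip.diff_right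
      by (simp add: sa)
    also have "\<dots> \<le> (norm x)\<^sup>2"
      using power_mono[OF norm_s[of "s x"] norm_ge_zero, of 2] zero_le_power2[of "norm (s x)"] by linarith
    finally show ?thesis by (rule power2_le_imp_le) simp
  qed
  let ?Y = "sqrt_iter A"
  note Y_lin = linear_sqrt_iter[OF A norm_A]
  define Z where "Z = (\<lambda>x. lim (\<lambda>n. ?Y n x))"
  have lim: "(\<lambda>n. ?Y n x) \<longlonglongrightarrow> Z x" for x
    using convergent_sqrt_iter[OF A norm_A] by (simp add: Z_def convergent_LIMSEQ_iff)
  have Z_add: "Z (x + y) = Z x + Z y" for x y
    using LIMSEQ_unique[OF lim[of "x + y"]] tendsto_add[OF lim[of x] lim[of y]]
    by (simp add: linear_add[OF Y_lin])
  have Z_scale: "Z (r *\<^sub>R x) = r *\<^sub>R Z x" for r x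
    using LIMSEQ_unique[OF lim[of "r *\<^sub>R x"]] tendsto_scaleR[OF tendsto_const lim[of x], of r]
    by (simp add: linear_scale[OF Y_lin])
  have Z_lin: "linear Z" by (intro linearI Z_add Z_scale)
  \<comment> \<open>Convergence is only pointwise; it survives squaring because the iterates are
    contractions.\<close>
  have ZZ: "(\<lambda>n. ?Y n (?Y n x)) \<longlonglongrightarrow> Z (Z x)" for x
  proof -
    have "(\<lambda>n. ?Y n (?Y n x - Z x)) \<longlonglongrightarrow> 0"
    proof (rule Lim_null_comparison)
      show "\<forall>\<^sub>F n in sequentially. norm (?Y n (?Y n x - Z x)) \<le> norm (?Y n x - Z x)"
        using norm_sqrt_iter[OF A norm_A] sqrt_iter_real_bounds
        by (intro always_eventually allI order_trans[OF norm_sqrt_iter[OF A norm_A]])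
          (auto intro: mult_left_le_one_le)
      show "(\<lambda>n. norm (?Y n x - Z x)) \<longlonglongrightarrow> 0"
        using tendsto_norm_zero[OF LIM_zero[OF lim[of x]]] .
    qed
    from tendsto_add[OF this lim[of "Z x"]] show ?thesis by (simp add: linear_diff[OF Y_lin])
  qed
  have Z_eq: "Z x = (1/2) *\<^sub>R (A x + Z (Z x))" for x
  proof (rule LIMSEQ_unique)
    show "(\<lambda>n. ?Y (Suc n) x) \<longlonglongrightarrow> Z x" using lim by (rule LIMSEQ_Suc)
    show "(\<lambda>n. ?Y (Suc n) x) \<longlonglongrightarrow> (1/2) *\<^sub>R (A x + Z (Z x))"
      by (simp, intro tendsto_intros ZZ)
  qed
  define g where "g = (\<lambda>x. x - Z x)"
  show ?thesis
  proof (rule that)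
    show "linear g" by (auto intro!: linearI simp: g_def Z_add Z_scale algebra_simps)
    have Y_sa: "cinner (?Y n x) y = cinner x (?Y n y)" for n x y
    proof (induction n arbitrary: x y)
      case (Suc n)
      have "cinner (A x) y = cinner x (A y)" by (simp add: A_def cip.diff_left cip.diff_right sa)
      then show ?case by (simp add: cip.scaleR_left cip.scaleR_right cip.add_left cip.add_right Suc)
    qed (simp add: cip.zero_left cip.zero_right)
    have "cinner (Z x) y = cinner x (Z y)" for x y
    proof (rule LIMSEQ_unique)
      show "(\<lambda>n. cinner (?Y n x) y) \<longlonglongrightarrow> cinner (Z x) y" by (intro cip.tendsto lim tendsto_const)
      show "(\<lambda>n. cinner (?Y n x) y) \<longlonglongrightarrow> cinner x (Z y)"
        unfolding Y_sa by (intro cip.tendsto lim tendsto_const)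
    qed
    then show "cinner (g x) y = cinner x (g y)" for x y by (simp add: g_def cip.diff_left cip.diff_right)
    show "g (g x) = s (s x)" for x
    proof -
      have "2 *\<^sub>R Z x = A x + Z (Z x)" by (subst Z_eq) simp
      then show ?thesis
        by (simp add: g_def linear_diff[OF Z_lin] A_def scaleR_2 algebra_simps)
    qed
    show "B (g x) = g (B x)" if B: "bounded_linear B" and c: "\<And>x. B (s (s x)) = s (s (B x))" for B x
    proof -
      interpret B: bounded_linear B by (rule B)
      have "(\<lambda>n. B (?Y n x)) \<longlonglongrightarrow> B (Z x)" by (intro B.tendsto lim)
      moreover have "B (?Y n x) = ?Y n (B x)" for n
        by (rule sqrt_iter_commute) (auto simp: A_def B.diff c B.linear_axioms)
      ultimately have "(\<lambda>n. ?Y n (B x)) \<longlonglongrightarrow> B (Z x)" by simp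
      then have "B (Z x) = Z (B x)" using lim by (rule LIMSEQ_unique)
      then show ?thesis by (simp add: g_def B.diff)
    qed
    show "g x \<in> K" if K: "subspace K" "closed K" "\<And>x. x \<in> K \<Longrightarrow> s x \<in> K" "x \<in> K" for K x
    proof -
      have "?Y n x \<in> K" if "x \<in> K" for n x
        using that K(1,3)
        by (induction n arbitrary: x) (auto simp: A_def subspace_0 subspace_add subspace_diff subspace_scale)
      then have "Z x \<in> K" using closed_sequentially[OF K(2) _ lim] K(4) by blast
      then show ?thesis using K by (simp add: g_def subspace_diff)
    qed
  qed
qed

section \<open>Operators whose square is a scalar\<close>

primrec alternating :: "bool \<Rightarrow> nat \<Rightarrow> bool list" where
  "alternating b 0 = []"
| "alternating b (Suc n) = b # alternating (\<not> b) n"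

lemma alternating_snoc: "alternating b (Suc n) = alternating b n @ [if even n then b else \<not> b]"
proof (induction n arbitrary: b)
  case (Suc n)
  have "alternating b (Suc (Suc n)) = b # alternating (\<not> b) (Suc n)" by simp
  also have "\<dots> = alternating b (Suc n) @ [if even (Suc n) then b else \<not> b]"
    unfolding Suc[of "\<not> b"] by simp
  finally show ?case .
qed simp

lemma rev_alternating: "rev (alternating b n) = alternating (if odd n then b else \<not> b) n"
proof (induction n)
  case (Suc n)
  then show ?case unfolding alternating_snoc[of b] by simp
qed simp

text \<open>Equal neighbours collapse to a scalar when both letters have scalar squares, so this
  leaves only alternating words to examine.\<close>

lemma double_or_alternating:
  "(\<exists>p b q. w = p @ b # b # q) \<or> (\<exists>b. w = alternating b (length w))"
proof (induction w)
  case (Cons a w)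
  then consider (double) p b q where "w = p @ b # b # q" | (alt) b where "w = alternating b (length w)"
    by blast
  then show ?case
  proof cases
    case double
    then have "a # w = (a # p) @ b # b # q" by simp
    then show ?thesis by blast
  next
    case alt
    show ?thesis
    proof (cases "w = [] \<or> a = (\<not> b)")
      case True
      then have "a # w = alternating a (length (a # w))" using alt by auto
      then show ?thesis by blast
    next
      case False
      then obtain w' where "w = b # w'" using alt by (cases "length w") auto
      then have "a # w = [] @ b # b # w'" using False by simp
      then show ?thesis by blast
    qed
  qed
qed simp

text \<open>The pairs are elements of the graph of a conjugate-linear map, hence the \<open>cnj\<close>.\<close>

inductive_set conj_span :: "('a::complex_inner_space \<times> 'a) set \<Rightarrow> ('a \<times> 'a) set" for E where
  base: "p \<in> E \<Longrightarrow> p \<in> conj_span E"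
| zero: "(0, 0) \<in> conj_span E"
| add: "p \<in> conj_span E \<Longrightarrow> q \<in> conj_span E \<Longrightarrow> (fst p + fst q, snd p + snd q) \<in> conj_span E"
| scale: "p \<in> conj_span E \<Longrightarrow> (scaleC a (fst p), scaleC (cnj a) (snd p)) \<in> conj_span E"

text \<open>\<open>Ts\<close> is a parameter tied to \<open>T\<close> by \<open>adj\<close>, so that
  a shifted operator and its shifted adjoint can be inserted directly.\<close>

locale scalar_square =
  fixes T Ts :: "'a::chilbert \<Rightarrow> 'a" and c :: complex
  assumes T: "bounded_clinear T" and Ts: "bounded_clinear Ts"
    and adj: "cinner (T x) y = cinner x (Ts y)"
    and TT: "T (T x) = scaleC c x"
begin

lemma adj': "cinner (Ts x) y = cinner x (T y)"
  unfolding cinner_commute[where y = x] cinner_commute[where x = y and y = "Ts x"] by (simp add: adj)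

lemma TsTs: "Ts (Ts x) = scaleC (cnj c) x"
  by (rule cinner_eqI) (simp flip: adj add: TT cinner_scaleC_left cinner_scaleC_right)

lemmas T_simps = bounded_clinearD(2-)[OF T] bounded_clinearD(2-)[OF Ts] TT TsTs

section \<open>The products \<open>U\<close> and \<open>V\<close>, and balanced vectors\<close>

definition U where "U x = T (Ts x)"
definition V where "V x = Ts (T x)"

lemma bounded_linear_UV: "bounded_linear U" "bounded_linear V"
  using bounded_linear_compose[OF bounded_clinearD(1)[OF T] bounded_clinearD(1)[OF Ts]]
    bounded_linear_compose[OF bounded_clinearD(1)[OF Ts] bounded_clinearD(1)[OF T]]
  by (simp_all add: U_def[abs_def] V_def[abs_def])

text \<open>The inner two letters of either product form a square, and so then do the outer two:
  both sides are \<open>c * cnj c\<close> times the vector.\<close>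

lemma UV_commute: "U (V x) = V (U x)"
  by (simp add: U_def V_def T_simps scaleC_scaleC mult.commute)

lemma funpow_V_U: "(V ^^ k) (U x) = U ((V ^^ k) x)"
  by (induction k) (simp_all add: UV_commute)

text \<open>Such a vector exists because \<open>T + T\<^sup>*\<close> intertwines \<open>T T\<^sup>*\<close> and \<open>T\<^sup>* T\<close>: if \<open>g\<close> is a square root of
  \<open>s\<^sup>2\<close> for \<open>s\<close> a multiple of \<open>T + T\<^sup>*\<close>, then \<open>(g + s) ((T T\<^sup>*)\<^sup>k - (T\<^sup>* T)\<^sup>k) (g + s)
  = ((T T\<^sup>*)\<^sup>k - (T\<^sup>* T)\<^sup>k) (g - s) (g + s) = 0\<close>.\<close>

lemma balanced_vector_exists:
  assumes K: "cvec.subspace K" "closed K" "K \<noteq> {0}"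
    and KT: "\<And>x. x \<in> K \<Longrightarrow> T x \<in> K" "\<And>x. x \<in> K \<Longrightarrow> Ts x \<in> K"
  obtains x where "x \<in> K" "x \<noteq> 0" "\<And>k. cinner x ((U ^^ k) x) = cinner x ((V ^^ k) x)"
proof (cases "\<exists>x\<in>K. x \<noteq> 0 \<and> U x = V x")
  case True
  then obtain x where x: "x \<in> K" "x \<noteq> 0" "U x = V x" by blast
  have "(U ^^ k) x = (V ^^ k) x" for k
    by (induction k) (simp_all flip: funpow_V_U add: x(3) funpow_swap1)
  then show ?thesis using that x by simp
next
  \<comment> \<open>Here \<open>U - V\<close> is injective on \<open>K\<close>; this will exclude
    that \<open>g + s\<close> vanishes on \<open>K\<close>.\<close>
  case False
  have K': "subspace K" using K(1) by (rule csubspace_imp_subspace)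
  have bl: "bounded_linear (\<lambda>x. T x + Ts x)"
    by (intro bounded_linear_add bounded_clinearD(1) T Ts)
  then obtain m where m: "m > 0" "\<And>x. norm (T x + Ts x) \<le> norm x * m"
    using bounded_linear.pos_bounded by blast
  \<comment> \<open>Dividing by an operator bound makes \<open>s\<close> a contraction, as the
    square root construction requires.\<close>
  define s where "s = (\<lambda>x. (1/m) *\<^sub>R (T x + Ts x))"
  have bs: "bounded_linear s"
    unfolding s_def by (intro bounded_linear_const_scaleR bl)
  have s_lin: "linear s" by (rule bounded_linear.linear[OF bs])
  have norm_s: "norm (s x) \<le> norm x" for x
    using m(1) m(2)[of x] by (simp add: s_def pos_divide_le_eq del: scaleR_add_right)
  have s_sa: "cinner (s x) y = cinner x (s y)" for x y
    by (simp add: s_def cip.scaleR_left cip.scaleR_right cip.add_left cip.add_right adj adj')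
  \<comment> \<open>Up to the factor \<open>1/m\<close>, both sides are
    \<open>c Ts + Ts T Ts\<close> applied to \<open>x\<close>.\<close>
  have sU: "s (U x) = V (s x)" for x
    by (simp add: s_def U_def V_def T_simps scaleR_scaleC scaleC_add_right cvec.scale_left_commute)
  have sV: "s (V x) = U (s x)" for x
    by (simp add: s_def U_def V_def T_simps scaleR_scaleC scaleC_add_right cvec.scale_left_commute)
  obtain g where g: "linear g" "\<And>x y. cinner (g x) y = cinner x (g y)" "\<And>x. g (g x) = s (s x)"
    "\<And>B x. bounded_linear B \<Longrightarrow> (\<And>x. B (s (s x)) = s (s (B x))) \<Longrightarrow> B (g x) = g (B x)"
    "\<And>K x. subspace K \<Longrightarrow> closed K \<Longrightarrow> (\<And>x. x \<in> K \<Longrightarrow> s x \<in> K) \<Longrightarrow> x \<in> K \<Longrightarrow> g x \<in> K"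
    using self_adjoint_sqrt_of_square[OF s_lin norm_s s_sa] by blast
  \<comment> \<open>\<open>s\<close> exchanges \<open>U\<close> and \<open>V\<close>, so its square
    commutes with both, and \<open>g\<close> inherits this.\<close>
  have gU: "U (g x) = g (U x)" and gV: "V (g x) = g (V x)" and gs: "s (g x) = g (s x)" for x
    by (rule g(4); simp add: bounded_linear_UV bs sU sV)+
  have sK: "s x \<in> K" if "x \<in> K" for x
    using that K' KT by (simp add: s_def subspace_add subspace_scale del: scaleR_add_right)
  have gK: "g x \<in> K" if "x \<in> K" for x
    using g(5)[OF K' K(2)] sK that by blast
  define D where "D k x = (U ^^ k) x - (V ^^ k) x" for k x
  have sUk: "s ((U ^^ k) x) = (V ^^ k) (s x)" and sVk: "s ((V ^^ k) x) = (U ^^ k) (s x)" for k x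
    by (induction k) (simp_all add: sU sV)
  have gUk: "g ((U ^^ k) x) = (U ^^ k) (g x)" and gVk: "g ((V ^^ k) x) = (V ^^ k) (g x)" for k x
    by (induction k) (simp_all flip: gU gV)
  have linUk: "linear (U ^^ k)" and linVk: "linear (V ^^ k)" for k
    using bounded_linear_UV by (induction k) (auto intro: linear_compose bounded_linear.linear simp: linear_id)
  have D_lin: "linear (D k)" for k
    unfolding D_def[abs_def] by (intro linear_compose_sub linUk linVk)
  have gD: "g (D k x) = D k (g x)" for k x by (simp add: D_def linear_diff[OF g(1)] gUk gVk)
  have sD: "s (D k x) = - D k (s x)" for k x by (simp add: D_def linear_diff[OF s_lin] sUk sVk)
  have balanced: "cinner x (D k x) = 0" if x: "x = g y + s y" for x y k
  proof -
    have "cinner x (D k x) = cinner y (g (D k x) + s (D k x))"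
      by (simp add: x cip.add_left cip.add_right g(2) s_sa)
    also have "g (D k x) + s (D k x) = D k (g x - s x)"
      by (simp add: gD sD linear_diff[OF D_lin])
    also have "g x - s x = 0"
      by (simp add: x linear_add[OF g(1)] linear_add[OF s_lin] g(3) gs)
    finally show ?thesis by (simp add: linear_0[OF D_lin] cip.zero_right)
  qed
  have "\<exists>y\<in>K. g y + s y \<noteq> 0"
  \<comment> \<open>If \<open>g = - s\<close> on \<open>K\<close>, then
    \<open>D 1 (g - s) = (g + s) (D 1)\<close> vanishes there, so \<open>g = s\<close> by
    injectivity of \<open>D 1\<close>. Hence \<open>s = 0\<close> and \<open>Ts = - T\<close> on
    \<open>K\<close>, and \<open>U\<close> and \<open>V\<close> agree there after all.\<close>
  proof (rule ccontr)
    assume "\<not> ?thesis"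
    then have 0: "g y + s y = 0" if "y \<in> K" for y using that by blast
    have Ts_eq: "Ts y = - T y" if y: "y \<in> K" for y
    proof -
      have DK: "D 1 y \<in> K" using y KT K' by (simp add: D_def U_def V_def subspace_diff)
      have "D 1 (g y - s y) = g (D 1 y) + s (D 1 y)" by (simp add: gD sD linear_diff[OF D_lin])
      also have "\<dots> = 0" using 0[OF DK] .
      finally have "U (g y - s y) = V (g y - s y)" by (simp add: D_def)
      moreover have "g y - s y \<in> K" using y sK gK K' by (simp add: subspace_diff)
      ultimately have "g y - s y = 0" using False by blast
      with 0[OF y] have "2 *\<^sub>R s y = 0" by (simp add: scaleR_2)
      then have "T y + Ts y = 0" using m(1) by (simp add: s_def del: scaleR_add_right)
      then show ?thesis by (simp add: eq_neg_iff_add_eq_0 add.commute)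
    qed
    obtain y where y: "y \<in> K" "y \<noteq> 0" using K(1,3) cvec.subspace_0 by blast
    have "U y = T (0 - T y)" by (simp add: U_def Ts_eq[OF y(1)])
    also have "\<dots> = - T (T y)" unfolding T_simps(3) by (simp add: T_simps)
    also have "\<dots> = V y" by (simp add: V_def Ts_eq[OF KT(1)[OF y(1)]])
    finally show False using False y by blast
  qed
  then obtain y where y: "y \<in> K" "g y + s y \<noteq> 0" by blast
  show ?thesis
  proof (rule that)
    show "g y + s y \<in> K" using y(1) sK gK K' by (simp add: subspace_add)
    show "cinner (g y + s y) ((U ^^ k) (g y + s y)) = cinner (g y + s y) ((V ^^ k) (g y + s y))" for k
      using balanced[OF refl, of y k] by (simp add: D_def cip.diff_right)
  qed (fact y(2))
qed


section \<open>The action of words in \<open>T\<close> and \<open>Ts\<close>\<close>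

primrec act :: "bool list \<Rightarrow> 'a \<Rightarrow> 'a" where
  "act [] x = x"
| "act (b # w) x = (if b then T else Ts) (act w x)"

lemma act_append: "act (v @ w) x = act v (act w x)"
  by (induction v) auto

lemma act_scaleC: "act w (scaleC a x) = scaleC a (act w x)"
  by (induction w) (auto simp: T_simps)

text \<open>Taking adjoints reverses a product and exchanges the two letters.\<close>

lemma cinner_act: "cinner (act w x) y = cinner x (act (rev (map Not w)) y)"
  by (induction w arbitrary: y) (auto simp: act_append adj adj')

lemma act_double: "act (p @ b # b # q) x = scaleC (if b then c else cnj c) (act (p @ q) x)"
  by (simp add: act_append T_simps act_scaleC)

lemma act_alternating: "act (alternating True (2 * k)) x = (U ^^ k) x"
    "act (alternating False (2 * k)) x = (V ^^ k) x"
  by (induction k) (simp_all add: U_def V_def)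

text \<open>A word with a repeated letter reduces to a scalar multiple of a shorter one, an alternating
  word of odd length is a palindrome, and those of even length are powers of \<open>T T\<^sup>*\<close> and \<open>T\<^sup>* T\<close>.\<close>

lemma cinner_act_rev:
  assumes "\<And>k. cinner x ((U ^^ k) x) = cinner x ((V ^^ k) x)"
  shows "cinner x (act (rev w) x) = cinner x (act w x)"
proof (induction w rule: length_induct)
  case (1 w)
  consider (double) p b q where "w = p @ b # b # q" | (alt) b where "w = alternating b (length w)"
    using double_or_alternating by blast
  then show ?case
  proof cases
    \<comment> \<open>The reversed word contains the same double letter, so both words shed the same
      scalar.\<close>
    case double
    then have "cinner x (act (rev (p @ q)) x) = cinner x (act (p @ q) x)"
      using 1[rule_format, of "p @ q"] by simp
    with double show ?thesis by (simp add: act_double cinner_scaleC_right)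
  next
    case alt
    show ?thesis
    proof (cases "even (length w)")
      case True
      then obtain k where k: "length w = 2 * k" by blast
      have "w = alternating b (2 * k)" "rev w = alternating (\<not> b) (2 * k)"
        using alt rev_alternating[of b "2 * k"] by (simp_all add: k)
      then show ?thesis using assms by (cases b) (simp_all add: act_alternating)
    next
      case False
      then have "rev w = w" using alt rev_alternating[of b "length w"] by simp
      then show ?thesis by simp
    qed
  qed
qed

section \<open>Partially defined conjugations\<close>

text \<open>\<open>partial_conjugation E\<close> says that \<open>E\<close> is contained in the graph of a conjugation
  \<open>C\<close> of the closed span of its domain with \<open>C T = T\<^sup>* C\<close>.\<close>

definition partial_conjugation :: "('a \<times> 'a) set \<Rightarrow> bool" where
  "partial_conjugation E \<longleftrightarrow>
     (\<forall>p\<in>E. \<forall>q\<in>E. cinner (snd p) (snd q) = cnj (cinner (fst p) (fst q))) \<and>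
     (\<forall>p\<in>E. (snd p, fst p) \<in> E \<and> (T (fst p), Ts (snd p)) \<in> E)"

lemma partial_conjugationD:
  assumes "partial_conjugation E"
  shows "(u, u') \<in> E \<Longrightarrow> (v, v') \<in> E \<Longrightarrow> cinner u' v' = cnj (cinner u v)"
    "(u, u') \<in> E \<Longrightarrow> (u', u) \<in> E" "(u, u') \<in> E \<Longrightarrow> (T u, Ts u') \<in> E"
  using assms unfolding partial_conjugation_def by force+

lemma partial_conjugation_Ts:
  assumes "partial_conjugation E" "(u, u') \<in> E"
  shows "(Ts u, T u') \<in> E"
  using assms partial_conjugationD by blast

lemma partial_conjugation_conj_span:
  assumes E: "partial_conjugation E"
  shows "partial_conjugation (conj_span E)"
proof -
  \<comment> \<open>The inner product identity extends to the span one argument at a time.\<close>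
  have *: "cinner (snd p) (snd q) = cnj (cinner (fst p) (fst q))"
    if "p \<in> E" "q \<in> conj_span E" for p q
    using that(2,1)
    by induction (use E in \<open>auto simp: partial_conjugation_def cip.zero_right cip.add_right cinner_scaleC_right\<close>)
  have "cinner (snd p) (snd q) = cnj (cinner (fst p) (fst q))"
    if "p \<in> conj_span E" "q \<in> conj_span E" for p q
    using that
    by induction (auto simp: * cip.zero_left cip.add_left cinner_scaleC_left)
  moreover have "(snd p, fst p) \<in> conj_span E \<and> (T (fst p), Ts (snd p)) \<in> conj_span E"
    if "p \<in> conj_span E" for p
    using that
  proof induction
    case (base p)
    then show ?case using E by (auto simp: partial_conjugation_def intro: conj_span.base)
  next
    case zero
    then show ?case by (simp add: T_simps conj_span.zero)
  next
    case (add p q)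
    then show ?case
      using conj_span.add[of "(snd p, fst p)" E "(snd q, fst q)"]
        conj_span.add[of "(T (fst p), Ts (snd p))" E "(T (fst q), Ts (snd q))"]
      by (simp add: T_simps)
  next
    case (scale p a)
    then show ?case
      using conj_span.scale[of "(snd p, fst p)" E "cnj a"]
        conj_span.scale[of "(T (fst p), Ts (snd p))" E a]
      by (simp add: T_simps)
  qed
  ultimately show ?thesis by (simp add: partial_conjugation_def)
qed

text \<open>Each condition is an equation between continuous functions or invariance under a
  continuous map.\<close>

lemma partial_conjugation_closure:
  assumes E: "partial_conjugation E"
  shows "partial_conjugation (closure E)"
proof -
  let ?G = "{z. cinner (snd (fst z)) (snd (snd z)) = cnj (cinner (fst (fst z)) (fst (snd z)))}"
  have "closed ?G"
    by (intro closed_Collect_eq cip.continuous_on continuous_on_cnj continuous_intros)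
  moreover have "E \<times> E \<subseteq> ?G" using partial_conjugationD(1)[OF E] by auto
  ultimately have "closure E \<times> closure E \<subseteq> ?G"
    unfolding closure_Times[symmetric] by (intro closure_minimal)
  moreover have "(\<lambda>p. (snd p, fst p)) ` closure E \<subseteq> closure E"
  proof (intro image_closure_subset)
    show "continuous_on (closure E) (\<lambda>p. (snd p, fst p))" by (intro continuous_intros)
    show "(\<lambda>p. (snd p, fst p)) ` E \<subseteq> closure E"
      using partial_conjugationD(2)[OF E] closure_subset[of E] by auto
  qed simp
  moreover have "(\<lambda>p. (T (fst p), Ts (snd p))) ` closure E \<subseteq> closure E"
  proof (intro image_closure_subset)
    show "continuous_on (closure E) (\<lambda>p. (T (fst p), Ts (snd p)))"
      by (intro continuous_on_Pair bounded_linear.continuous_on[OF bounded_clinearD(1)[OF T]]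
          bounded_linear.continuous_on[OF bounded_clinearD(1)[OF Ts]] continuous_intros)
    show "(\<lambda>p. (T (fst p), Ts (snd p))) ` E \<subseteq> closure E"
      using partial_conjugationD(3)[OF E] closure_subset[of E] by auto
  qed simp
  ultimately show ?thesis
    unfolding partial_conjugation_def by (auto simp: image_subset_iff subset_iff)
qed

text \<open>Zorn applies because each condition involves at most two pairs, which lie in a common
  member of a chain.\<close>

lemma maximal_partial_conjugation:
  obtains E where "partial_conjugation E" "\<And>F. partial_conjugation F \<Longrightarrow> E \<subseteq> F \<Longrightarrow> F = E"
proof -
  have "\<exists>E\<in>Collect partial_conjugation. \<forall>F\<in>Collect partial_conjugation. E \<subseteq> F \<longrightarrow> F = E"
  proof (rule subset_Zorn_nonempty)
    have "partial_conjugation {}" by (simp add: partial_conjugation_def)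
    then show "Collect partial_conjugation \<noteq> {}" by blast
    fix \<C> assume ch: "subset.chain (Collect partial_conjugation) \<C>"
    have pc: "partial_conjugation E" if "E \<in> \<C>" for E
      using ch that by (auto simp: subset_chain_def)
    have "cinner (snd p) (snd q) = cnj (cinner (fst p) (fst q))"
      if "p \<in> \<Union>\<C>" "q \<in> \<Union>\<C>" for p q
    proof -
      obtain E F where EF: "E \<in> \<C>" "F \<in> \<C>" "p \<in> E" "q \<in> F" using \<open>p \<in> \<Union>\<C>\<close> \<open>q \<in> \<Union>\<C>\<close> by blast
      then have "E \<subseteq> F \<or> F \<subseteq> E" using ch by (auto simp: subset_chain_def)
      then show ?thesis using EF pc[of E] pc[of F] unfolding partial_conjugation_def by blast
    qed
    then show "\<Union>\<C> \<in> Collect partial_conjugation"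
      using pc unfolding partial_conjugation_def mem_Collect_eq by blast
  qed
  then show ?thesis using that by auto
qed

text \<open>The domain of \<open>E\<close> is invariant under \<open>T\<close> and
  \<open>Ts\<close>, so orthogonality to \<open>x\<close> spreads to its whole orbit and the mixed
  inner products vanish. Within the orbit, the identity is invariance under word reversal.\<close>

lemma partial_conjugation_Un_orbit:
  assumes E: "partial_conjugation E"
    and x: "\<And>k. cinner x ((U ^^ k) x) = cinner x ((V ^^ k) x)"
    and orth: "\<And>p. p \<in> E \<Longrightarrow> cinner (fst p) x = 0"
  shows "partial_conjugation (E \<union> range (\<lambda>w. (act w x, act (map Not w) x)))"
proof -
  have orth': "cinner (fst p) (act w x) = 0" if "p \<in> E" for p w
    using that
  proof (induction w arbitrary: p)
    case (Cons b w)
    obtain u u' where p: "p = (u, u')" by force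
    have "(T u, Ts u') \<in> E" "(Ts u, T u') \<in> E"
      using E Cons.prems partial_conjugationD(3) partial_conjugation_Ts unfolding p by blast+
    then have "cinner (T u) (act w x) = 0" "cinner (Ts u) (act w x) = 0" using Cons.IH by fastforce+
    then show ?case by (simp add: p adj adj')
  qed (simp add: orth)
  have orth'': "cinner (snd p) (act w x) = 0" if "p \<in> E" for p w
    using orth'[of "(snd p, fst p)" w] E that by (simp add: partial_conjugation_def)
  have gram: "cinner (act (map Not v) x) (act (map Not w) x) = cnj (cinner (act v x) (act w x))" for v w
  proof -
    have "cinner (act (map Not v) x) (act (map Not w) x) = cinner x (act (rev v @ map Not w) x)"
      by (simp add: cinner_act act_append rev_map comp_def)
    \<comment> \<open>The reversed word is the adjoint of the word \<open>w\<close> followed by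
      \<open>v\<close>, so it yields the inner product with the roles of \<open>v\<close> and
      \<open>w\<close> exchanged.\<close>
    also have "\<dots> = cinner x (act (rev (rev v @ map Not w)) x)"
      by (rule cinner_act_rev[OF x, symmetric])
    also have "\<dots> = cinner (act w x) (act v x)"
      by (simp add: cinner_act act_append)
    also have "\<dots> = cnj (cinner (act v x) (act w x))" by (rule cinner_commute)
    finally show ?thesis .
  qed
  have orth_left: "cinner (act w x) (fst p) = 0" "cinner (act w x) (snd p) = 0" if "p \<in> E" for p w
    using orth'[OF that] orth''[OF that] cinner_eq_0_sym by blast+
  have step: "(snd p, fst p) \<in> range (\<lambda>w. (act w x, act (map Not w) x)) \<and>
      (T (fst p), Ts (snd p)) \<in> range (\<lambda>w. (act w x, act (map Not w) x))"
    if p: "p = (act w x, act (map Not w) x)" for p w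
  proof
    show "(snd p, fst p) \<in> range (\<lambda>w. (act w x, act (map Not w) x))"
      by (rule image_eqI[of _ _ "map Not w"]) (simp_all add: p comp_def)
    show "(T (fst p), Ts (snd p)) \<in> range (\<lambda>w. (act w x, act (map Not w) x))"
      by (rule image_eqI[of _ _ "True # w"]) (simp_all add: p)
  qed
  show ?thesis
    unfolding partial_conjugation_def
  proof (intro conjI ballI)
    fix p q assume "p \<in> E \<union> range (\<lambda>w. (act w x, act (map Not w) x))"
      "q \<in> E \<union> range (\<lambda>w. (act w x, act (map Not w) x))"
    then show "cinner (snd p) (snd q) = cnj (cinner (fst p) (fst q))"
      using E by (auto simp: gram orth' orth'' orth_left partial_conjugation_def)
  next
    fix p assume "p \<in> E \<union> range (\<lambda>w. (act w x, act (map Not w) x))"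
    then show "(snd p, fst p) \<in> E \<union> range (\<lambda>w. (act w x, act (map Not w) x))"
      "(T (fst p), Ts (snd p)) \<in> E \<union> range (\<lambda>w. (act w x, act (map Not w) x))"
      using E step by (auto simp: partial_conjugation_def)
  qed
qed

text \<open>Maximality makes \<open>E\<close> a closed conjugate-linear graph. The orthogonal
  complement of its domain is invariant under \<open>T\<close> and \<open>Ts\<close>, so a nonzero
  complement would contain a balanced vector with which to enlarge \<open>E\<close>.\<close>

lemma conjugation_exists: "\<exists>C. conjugation C \<and> (\<forall>x. C (T x) = Ts (C x))"
proof -
  obtain E where E: "partial_conjugation E"
    and max: "\<And>F. partial_conjugation F \<Longrightarrow> E \<subseteq> F \<Longrightarrow> F = E"
    using maximal_partial_conjugation by blast
  have span: "conj_span E = E"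
    by (rule max[OF partial_conjugation_conj_span[OF E]]) (auto intro: conj_span.base)
  have closed: "closed E"
    using max[OF partial_conjugation_closure[OF E] closure_subset] closed_closure[of E] by simp
  have zero: "(0, 0) \<in> E" using conj_span.zero[of E] by (simp add: span)
  have add: "(u + v, u' + v') \<in> E" if "(u, u') \<in> E" "(v, v') \<in> E" for u u' v v'
    using conj_span.add[of "(u, u')" E "(v, v')"] that by (simp add: span)
  have scale: "(scaleC a u, scaleC (cnj a) u') \<in> E" if "(u, u') \<in> E" for a u u'
    using conj_span.scale[of "(u, u')" E a] that by (simp add: span)
  have diff: "(u - v, u' - v') \<in> E" if "(u, u') \<in> E" "(v, v') \<in> E" for u u' v v'
    using add[OF that(1) scale[OF that(2), of "-1"]] by (simp add: scaleC_one)
  have iso: "norm u' = norm u" if "(u, u') \<in> E" for u u'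
    using partial_conjugationD(1)[OF E that that]
    by (simp add: cinner_norm flip: of_real_power)
  have uniq: "u' = u''" if "(u, u') \<in> E" "(u, u'') \<in> E" for u u' u''
    using iso[OF diff[OF that]] by simp
  have dom: "u \<in> fst ` E \<longleftrightarrow> (\<exists>u'. (u, u') \<in> E)" for u by force
  \<comment> \<open>A projection of a closed set need not be closed; here the isometry makes the
    second components converge too.\<close>
  have dom_closed: "closed (fst ` E)"
    unfolding closed_sequential_limits
  proof (intro allI impI, elim conjE)
    fix f l assume f: "\<forall>n. f n \<in> fst ` E" and l: "f \<longlonglongrightarrow> l"
    then have "\<exists>u'. (f n, u') \<in> E" for n by (metis imageE prod.collapse)
    then obtain f' where f': "\<And>n. (f n, f' n) \<in> E" by metis
    have "dist (f' m) (f' n) = dist (f m) (f n)" for m n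
      using iso[OF diff[OF f'[of m] f'[of n]]] by (simp add: dist_norm)
    then have "Cauchy f'" using LIMSEQ_imp_Cauchy[OF l] by (simp add: Cauchy_def)
    then obtain l' where "f' \<longlonglongrightarrow> l'" using Cauchy_convergent convergent_def by blast
    then have "(\<lambda>n. (f n, f' n)) \<longlonglongrightarrow> (l, l')" using l by (intro tendsto_Pair)
    then have "(l, l') \<in> E" by (rule closed_sequentially[OF closed f'])
    then show "l \<in> fst ` E" by force
  qed
  have dom_subspace: "cvec.subspace (fst ` E)"
    unfolding cvec.subspace_def Ball_def dom using zero add scale by meson
  have "fst ` E = UNIV"
  proof (rule ccontr)
    assume "fst ` E \<noteq> UNIV"
    then obtain z where z: "z \<noteq> 0" "\<And>u. u \<in> fst ` E \<Longrightarrow> cinner u z = 0"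
      by (rule closed_csubspace_orthogonal_vector[OF dom_subspace dom_closed]) meson
    define K where "K = {y. \<forall>u\<in>fst ` E. cinner u y = 0}"
    have "cvec.subspace K"
      by (auto simp: cvec.subspace_def K_def cip.zero_right cip.add_right cinner_scaleC_right)
    moreover have "closed K"
    proof -
      have "K = (\<Inter>u\<in>fst ` E. {y. cinner u y = 0})" by (auto simp: K_def)
      then show ?thesis
        by (auto intro!: closed_INT closed_Collect_eq cip.continuous_on continuous_intros)
    qed
    moreover have "z \<in> K" using z(2) unfolding K_def by blast
    then have "K \<noteq> {0}" using z(1) by blast
    moreover have "T y \<in> K" "Ts y \<in> K" if y: "y \<in> K" for y
    proof -
      have "cinner (T u) y = 0" "cinner (Ts u) y = 0" if "u \<in> fst ` E" for u
        using that y partial_conjugationD(3)[OF E] partial_conjugation_Ts[OF E]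
        unfolding K_def dom mem_Collect_eq Ball_def by meson+
      then show "T y \<in> K" "Ts y \<in> K" by (simp_all add: K_def flip: adj adj')
    qed
    ultimately obtain x where x: "x \<in> K" "x \<noteq> 0" "\<And>k. cinner x ((U ^^ k) x) = cinner x ((V ^^ k) x)"
      using balanced_vector_exists by blast
    \<comment> \<open>Maximality absorbs the orbit of \<open>x\<close>; the empty word then puts
      \<open>x\<close> into the domain, to which it is orthogonal.\<close>
    have "E \<union> range (\<lambda>w. (act w x, act (map Not w) x)) = E"
      using x by (intro max partial_conjugation_Un_orbit E) (auto simp: K_def)
    moreover have "(x, x) \<in> range (\<lambda>w. (act w x, act (map Not w) x))"
      by (rule image_eqI[of _ _ "[]"]) simp_all
    ultimately have "x \<in> fst ` E" by force
    then have "cinner x x = 0" using x(1) unfolding K_def by blast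
    then show False using x(2) by (simp add: cinner_self_eq_0_iff)
  qed
  then have "\<exists>u'. (u, u') \<in> E" for u by (metis UNIV_I imageE prod.collapse)
  then obtain C where C: "\<And>u. (u, C u) \<in> E" by metis
  have C_eq: "C u = u'" if "(u, u') \<in> E" for u u' using uniq C that by blast
  have "conjugation C"
    unfolding conjugation_def
    using C_eq[OF add[OF C C]] C_eq[OF scale[OF C]] iso[OF C]
      C_eq[OF partial_conjugationD(2)[OF E C]] by simp
  then show ?thesis using C_eq[OF partial_conjugationD(3)[OF E C]] by auto
qed

end

section \<open>Reduction of degree at most two to a scalar square\<close>

lemma scalar_square_of_degree_le_2:
  fixes T :: "'a::complex_inner_space \<Rightarrow> 'a"
  assumes T: "bounded_clinear T" and "algebraic_op T" "alg_degree T \<le> 2"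
  obtains l c where "\<And>x. T (T x - scaleC l x) - scaleC l (T x - scaleC l x) = scaleC c x"
proof -
  have "\<exists>p. p \<noteq> 0 \<and> degree p = alg_degree T \<and> poly_op p T = (\<lambda>_. 0)"
    using \<open>algebraic_op T\<close>
      LeastI_ex[of "\<lambda>n. \<exists>p. p \<noteq> 0 \<and> degree p = n \<and> poly_op p T = (\<lambda>_. 0)"]
    unfolding alg_degree_def algebraic_op_def by blast
  then obtain p where p: "p \<noteq> 0" "degree p \<le> 2" "poly_op p T = (\<lambda>_. 0)" using assms(3) by auto
  define a where "a = coeff p"
  have eq: "scaleC (a 0) x + scaleC (a 1) (T x) + scaleC (a 2) (T (T x)) = 0" for x
  proof -
    have "0 = (\<Sum>i\<le>degree p. scaleC (a i) ((T ^^ i) x))"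
      using fun_cong[OF p(3), of x] by (simp add: poly_op_def a_def)
    also have "\<dots> = (\<Sum>i\<le>2. scaleC (a i) ((T ^^ i) x))"
      using p(2) by (intro sum.mono_neutral_left) (auto simp: a_def coeff_eq_0)
    finally show ?thesis by (simp add: numeral_2_eq_2 add.assoc)
  qed
  consider (two) "a 2 \<noteq> 0" | (one) "a 2 = 0" "a 1 \<noteq> 0" | (zero) "a 2 = 0" "a 1 = 0" "a 0 \<noteq> 0"
  proof -
    have "degree p = 0 \<or> degree p = 1 \<or> degree p = 2" using p(2) by auto
    moreover have "a (degree p) \<noteq> 0" using p(1) by (simp add: a_def)
    ultimately show ?thesis using that by metis
  qed
  then show ?thesis
  proof cases
    case two
    \<comment> \<open>Completing the square in
      \<open>a 2 * t\<^sup>2 + a 1 * t + a 0\<close>.\<close>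
    define l where "l = - (a 1 / (2 * a 2))"
    have "T (T x - scaleC l x) - scaleC l (T x - scaleC l x) = scaleC (l * l - a 0 / a 2) x" for x
    proof -
      have "scaleC (1 / a 2) (scaleC (a 0) x + scaleC (a 1) (T x) + scaleC (a 2) (T (T x))) = 0"
        unfolding eq by simp
      then have "scaleC (a 0 / a 2) x + scaleC (a 1 / a 2) (T x) + T (T x) = 0"
        using two by (simp add: scaleC_add_right scaleC_scaleC scaleC_one)
      moreover have "a 1 / a 2 = - l - l" by (simp add: l_def)
      moreover have "scaleC (l * 2) (T x) = scaleC l (T x) + scaleC l (T x)"
        by (simp only: mult_2_right scaleC_add_left)
      ultimately have "T (T x) = scaleC l (T x) + scaleC l (T x) - scaleC (a 0 / a 2) x"
        by (simp add: cvec.scale_left_diff_distrib algebra_simps)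
      then show ?thesis
        by (simp add: bounded_clinearD[OF T] cvec.scale_right_diff_distrib cvec.scale_left_diff_distrib)
    qed
    then show ?thesis by (rule that)
  next
    case one
    have "T x - scaleC (- (a 0 / a 1)) x = 0" for x
    proof -
      have "scaleC (1 / a 1) (scaleC (a 0) x + scaleC (a 1) (T x)) = 0"
        using eq[of x] one by simp
      then show ?thesis
        using one by (simp add: scaleC_add_right scaleC_scaleC scaleC_one add.commute)
    qed
    then show ?thesis using that[of "- (a 0 / a 1)" 0] by (simp add: bounded_clinearD[OF T])
  next
    case zero
    \<comment> \<open>A nonzero constant annihilates every vector, so the space is trivial and any
      scalars will do.\<close>
    then have "x = 0" for x :: 'a using eq[of x] by simp
    then show ?thesis using that[of 0 0] by metis
  qed
qed

text \<open>A conjugation turns the scalar \<open>l\<close> into \<open>cnj l\<close>, precisely the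
  shift of the adjoint, so intertwining the shifted operators is intertwining \<open>T\<close> and
  its adjoint.\<close>

theorem complex_symmetric_of_degree_le_2:
  fixes T :: "'a::chilbert \<Rightarrow> 'a"
  assumes T: "bounded_clinear T" and alg: "algebraic_op T" "alg_degree T \<le> 2"
  shows "complex_symmetric T"
proof -
  obtain l c where lc: "\<And>x. T (T x - scaleC l x) - scaleC l (T x - scaleC l x) = scaleC c x"
    using scalar_square_of_degree_le_2[OF T alg] by blast
  have shift: "bounded_clinear (\<lambda>x. S x - scaleC a x)" if "bounded_clinear S" for S :: "'a \<Rightarrow> 'a" and a
    using that unfolding bounded_clinear_def
    by (auto intro: bounded_linear_sub csc.bounded_linear_right
        simp: cvec.scale_right_diff_distrib mult.commute)
  let ?Ts = "Defs.adjoint T"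
  interpret scalar_square "\<lambda>x. T x - scaleC l x" "\<lambda>x. ?Ts x - scaleC (cnj l) x" c
    by unfold_locales
      (auto intro!: shift T bounded_clinear_adjoint
        simp: lc cip.diff_left cip.diff_right cinner_adjoint[OF T] cinner_scaleC_left cinner_scaleC_right)
  obtain C where C: "conjugation C" and CT: "\<And>x. C (T x - scaleC l x) = ?Ts (C x) - scaleC (cnj l) (C x)"
    using conjugation_exists by blast
  have add: "C (x + y) = C x + C y" and scale: "C (scaleC a x) = scaleC (cnj a) (C x)"
    and inv: "C (C x) = x" for x y a
    using C by (auto simp: conjugation_def)
  have "C (T x) = ?Ts (C x)" for x
    using CT[of x] add[of "T x - scaleC l x" "scaleC l x"] by (simp add: scale)
  then have "T x = C (?Ts (C x))" for x by (metis inv)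
  then show ?thesis unfolding complex_symmetric_def using C by (auto simp: fun_eq_iff)
qed

section \<open>A weighted shift that is not complex symmetric\<close>

text \<open>Gram-Schmidt: while \<open>k < card S\<close>, some element of \<open>S\<close> lies
  outside the span of the \<open>k\<close> vectors already chosen.\<close>

lemma orthonormal_family_exists:
  fixes S :: "'a::complex_inner_space set"
  assumes S: "finite S" "\<not> cdependent S"
  obtains e :: "nat \<Rightarrow> 'a"
  where "\<And>i j. i < card S \<Longrightarrow> j < card S \<Longrightarrow> cinner (e i) (e j) = (if i = j then 1 else 0)"
proof -
  have "\<exists>e::nat \<Rightarrow> 'a. \<forall>i<k. \<forall>j<k. cinner (e i) (e j) = (if i = j then 1 else 0)" if "k \<le> card S" for k
    using that
  proof (induction k)
    case (Suc k)
    then obtain e :: "nat \<Rightarrow> 'a"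
      where e: "\<And>i j. i < k \<Longrightarrow> j < k \<Longrightarrow> cinner (e i) (e j) = (if i = j then 1 else 0)"
      by auto
    have "\<not> S \<subseteq> cvec.span (e ` {..<k})"
    proof
      assume "S \<subseteq> cvec.span (e ` {..<k})"
      then have "card S \<le> card (e ` {..<k})"
        using cvec.independent_span_bound[of "e ` {..<k}" S] S(2) by simp
      also have "\<dots> \<le> k" using card_image_le[of "{..<k}" e] by simp
      finally show False using Suc.prems by simp
    qed
    then obtain s where s: "s \<in> S" "s \<notin> cvec.span (e ` {..<k})" by blast
    define v where "v = s - (\<Sum>i<k. scaleC (cinner (e i) s) (e i))"
    have "(\<Sum>i<k. scaleC (cinner (e i) s) (e i)) \<in> cvec.span (e ` {..<k})"
      by (intro cvec.span_sum cvec.span_scale cvec.span_base) auto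
    then have "v \<noteq> 0" using s(2) by (auto simp: v_def)
    have ev: "cinner (e j) v = 0" if "j < k" for j
    proof -
      have "cinner (e j) v = cinner (e j) s - (\<Sum>i<k. cinner (e i) s * cinner (e j) (e i))"
        by (simp add: v_def cip.diff_right cip.sum_right cinner_scaleC_right)
      also have "(\<Sum>i<k. cinner (e i) s * cinner (e j) (e i)) = (\<Sum>i<k. if i = j then cinner (e i) s else 0)"
        using that by (intro sum.cong) (auto simp: e)
      finally show ?thesis using that by simp
    qed
    define u where "u = scaleC (complex_of_real (1 / norm v)) v"
    have "norm u = 1" using \<open>v \<noteq> 0\<close> by (simp add: u_def norm_scaleC norm_divide)
    then have "cinner u u = 1" by (simp add: cinner_norm)
    moreover have "cinner (e j) u = 0" "cinner u (e j) = 0" if "j < k" for j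
      using ev[OF that] cinner_eq_0_sym[of v "e j"]
      by (simp_all add: u_def cinner_scaleC_right cinner_scaleC_left)
    ultimately have "\<forall>i<Suc k. \<forall>j<Suc k. cinner ((e(k := u)) i) ((e(k := u)) j) = (if i = j then 1 else 0)"
      using e by (auto simp: less_Suc_eq)
    then show ?case by blast
  qed simp
  then show ?thesis using that by blast
qed

text \<open>The indices run from 0 to \<open>N\<close>, so the degree will be \<open>Suc N\<close>.
  With \<open>N \<ge> 2\<close> the first and the last weight have different positions and
  differ.\<close>

locale weighted_shift =
  fixes e :: "nat \<Rightarrow> 'a::chilbert" and N :: nat
  assumes N: "N \<ge> 2"
    and e: "i \<le> N \<Longrightarrow> j \<le> N \<Longrightarrow> cinner (e i) (e j) = (if i = j then 1 else 0)"
begin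

definition weight :: "nat \<Rightarrow> complex" where
  "weight i = (if i = 0 then 2 else 1)"

text \<open>Vectors orthogonal to the family are sent to 0, which defines the operator on a space of
  any larger dimension.\<close>

definition shift :: "'a \<Rightarrow> 'a" where
  "shift x = (\<Sum>i<N. scaleC (weight i * cinner (e i) x) (e (Suc i)))"

definition shift_adj :: "'a \<Rightarrow> 'a" where
  "shift_adj x = (\<Sum>i<N. scaleC (weight i * cinner (e (Suc i)) x) (e i))"

lemma norm_e: "i \<le> N \<Longrightarrow> norm (e i) = 1"
  using e[of i i] norm_sq_cinner[of "e i"] norm_ge_zero[of "e i"] by (simp add: power2_eq_1_iff)

lemma bounded_clinear_shift: "bounded_clinear shift"
proof -
  have "bounded_linear shift"
    unfolding shift_def[abs_def]
    by (intro bounded_linear_sum bounded_linear_compose[OF csc.bounded_linear_left]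
        bounded_linear_const_mult cip.bounded_linear_right)
  moreover have "shift (scaleC a x) = scaleC a (shift x)" for a x
    by (simp add: shift_def cvec.scale_sum_right cinner_scaleC_right mult.left_commute)
  ultimately show ?thesis by (simp add: bounded_clinear_def)
qed

lemma cinner_shift: "cinner (shift x) y = cinner x (shift_adj y)"
proof -
  have "cnj (weight i * cinner (e i) x) * cinner (e (Suc i)) y
      = weight i * cinner (e (Suc i)) y * cinner x (e i)" for i
    by (simp add: weight_def flip: cinner_commute)
  then show ?thesis
    unfolding shift_def shift_adj_def cip.sum_left cip.sum_right cinner_scaleC_left cinner_scaleC_right
    by (rule sum.cong[OF refl])
qed

lemma adjoint_shift: "Defs.adjoint shift = shift_adj"
  by (rule adjoint_eqI) (rule cinner_shift)

lemma shift_e: "i < N \<Longrightarrow> shift (e i) = scaleC (weight i) (e (Suc i))"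
proof -
  assume i: "i < N"
  have "shift (e i) = (\<Sum>j<N. if j = i then scaleC (weight i) (e (Suc i)) else 0)"
    unfolding shift_def using i by (intro sum.cong) (auto simp: e)
  then show ?thesis using i by simp
qed

lemma shift_adj_e: "i < N \<Longrightarrow> shift_adj (e (Suc i)) = scaleC (weight i) (e i)"
proof -
  assume i: "i < N"
  have "shift_adj (e (Suc i)) = (\<Sum>j<N. if j = i then scaleC (weight i) (e i) else 0)"
    unfolding shift_adj_def using i by (intro sum.cong) (auto simp: e)
  then show ?thesis using i by simp
qed

lemma shift_adj_e0: "shift_adj (e 0) = 0"
  unfolding shift_adj_def by (intro sum.neutral) (auto simp: e)

lemma shift_eN: "shift (e N) = 0"
  unfolding shift_def by (intro sum.neutral) (auto simp: e)

lemma cinner_shift': "cinner (shift_adj x) y = cinner x (shift y)"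
  unfolding cinner_commute[where y = x] cinner_commute[where x = y and y = "shift_adj x"]
  by (simp add: cinner_shift)

text \<open>Each \<open>shift\<close> moved across the inner product lowers the index by one, up to
  a scalar, and \<open>shift_adj\<close> kills \<open>e 0\<close>.\<close>

lemma cinner_funpow_shift: "j < k \<Longrightarrow> j \<le> N \<Longrightarrow> cinner (e j) ((shift ^^ k) x) = 0"
proof (induction k arbitrary: j)
  case (Suc k)
  show ?case
  proof (cases j)
    case 0
    then show ?thesis by (simp flip: cinner_shift' add: shift_adj_e0 cip.zero_left)
  next
    case (Suc i)
    then show ?thesis
      using Suc.IH[of i] Suc.prems by (simp flip: cinner_shift' add: shift_adj_e cinner_scaleC_left)
  qed
qed simp

text \<open>Mirror image: the index rises instead, and \<open>shift\<close> kills
  \<open>e N\<close>.\<close>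

lemma cinner_funpow_shift_adj: "N < j + k \<Longrightarrow> j \<le> N \<Longrightarrow> cinner (e j) ((shift_adj ^^ k) x) = 0"
proof (induction k arbitrary: j)
  case (Suc k)
  show ?case
  proof (cases "j = N")
    case True
    then show ?thesis by (simp flip: cinner_shift add: shift_eN cip.zero_left)
  next
    case False
    then show ?thesis
      using Suc.IH[of "Suc j"] Suc.prems by (simp flip: cinner_shift add: shift_e cinner_scaleC_left)
  qed
qed simp

lemma funpow_shift_e0: "i \<le> N \<Longrightarrow> (shift ^^ i) (e 0) = scaleC (if i = 0 then 1 else 2) (e i)"
  by (induction i)
    (auto simp: scaleC_one shift_e weight_def bounded_clinearD(2)[OF bounded_clinear_shift])

lemma funpow_shift_eq_0: "(shift ^^ Suc N) x = 0"
  by (simp add: shift_def[of "(shift ^^ N) x"] cinner_funpow_shift cip.zero_left)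

lemma funpow_shift_adj_multiple: "\<exists>b. (shift_adj ^^ N) x = scaleC b (e 0)"
proof -
  let ?y = "(shift_adj ^^ (N - 1)) x"
  have "(shift_adj ^^ Suc (N - 1)) x = shift_adj ?y" by simp
  \<comment> \<open>With \<open>N - 1\<close> factors in \<open>?y\<close>, its coefficients at
    \<open>e (Suc i)\<close> vanish once \<open>i \<ge> 1\<close>.\<close>
  also have "\<dots> = (\<Sum>i<N. if i = 0 then scaleC (weight 0 * cinner (e 1) ?y) (e 0) else 0)"
    unfolding shift_adj_def[of ?y] by (intro sum.cong) (auto simp: cinner_funpow_shift_adj)
  also have "\<dots> = scaleC (weight 0 * cinner (e 1) ?y) (e 0)" using N by simp
  finally have "(shift_adj ^^ N) x = scaleC (weight 0 * cinner (e 1) ?y) (e 0)" using N by simp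
  then show ?thesis by blast
qed

lemma poly_op_shift_monom: "poly_op (monom 1 (Suc N)) shift = (\<lambda>_. 0)"
proof
  fix x
  have "poly_op (monom 1 (Suc N)) shift x = (\<Sum>i\<le>Suc N. 0)"
    unfolding poly_op_def degree_monom_eq[OF one_neq_zero]
    by (intro sum.cong refl) (auto simp: funpow_shift_eq_0 simp del: funpow.simps)
  then show "poly_op (monom 1 (Suc N)) shift x = 0" by simp
qed

text \<open>For \<open>i \<le> N\<close> the powers send \<open>e 0\<close> to nonzero multiples of
  distinct \<open>e i\<close>, so pairing with \<open>e (degree p)\<close> isolates the leading
  coefficient.\<close>

lemma degree_ge_of_poly_op_shift:
  assumes p: "p \<noteq> 0" "poly_op p shift = (\<lambda>_. 0)"
  shows "Suc N \<le> degree p"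
proof (rule ccontr)
  assume "\<not> ?thesis"
  then have d: "degree p \<le> N" by simp
  let ?d = "degree p"
  have "0 = cinner (e ?d) (poly_op p shift (e 0))" by (simp add: p(2) cip.zero_right)
  also have "\<dots> = (\<Sum>i\<le>?d. coeff p i * cinner (e ?d) ((shift ^^ i) (e 0)))"
    by (simp add: poly_op_def cip.sum_right cinner_scaleC_right)
  also have "\<dots> = (\<Sum>i\<le>?d. if i = ?d then coeff p i * (if i = 0 then 1 else 2) else 0)"
    using d by (intro sum.cong) (auto simp: funpow_shift_e0 e cinner_scaleC_right)
  finally show False using p(1) by (simp split: if_splits)
qed

lemma algebraic_op_shift: "algebraic_op shift"
  unfolding algebraic_op_def using poly_op_shift_monom by (metis monom_eq_0_iff one_neq_zero)

lemma alg_degree_shift: "alg_degree shift = Suc N"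
  unfolding alg_degree_def
proof (rule Least_equality)
  show "\<exists>p. p \<noteq> 0 \<and> degree p = Suc N \<and> poly_op p shift = (\<lambda>_. 0)"
    using poly_op_shift_monom degree_monom_eq[of "1::complex" "Suc N"]
    by (intro exI[of _ "monom 1 (Suc N)"]) (simp add: monom_eq_0_iff)
qed (use degree_ge_of_poly_op_shift in blast)

text \<open>A conjugation \<open>C\<close> as in the definition maps the range of \<open>shift ^^ N\<close>, spanned by \<open>e N\<close>, to the
  range of \<open>shift_adj ^^ N\<close>, spanned by \<open>e 0\<close>, so that \<open>norm (shift_adj (e N)) = norm (shift (e 0))\<close>.\<close>

lemma not_complex_symmetric_shift: "\<not> complex_symmetric shift"
proof
  assume "complex_symmetric shift"
  then obtain C where C: "conjugation C" and eq: "shift = C \<circ> shift_adj \<circ> C"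
    by (auto simp: complex_symmetric_def adjoint_shift)
  have scale: "C (scaleC a x) = scaleC (cnj a) (C x)" and iso: "norm (C x) = norm x"
    and inv: "C (C x) = x" for x a
    using C by (auto simp: conjugation_def)
  have shift_C: "shift (C x) = C (shift_adj x)" for x using fun_cong[OF eq, of "C x"] by (simp add: inv)
  have C_shift: "C (shift x) = shift_adj (C x)" for x using fun_cong[OF eq, of x] by (simp add: inv)
  have C_funpow: "C ((shift ^^ k) x) = (shift_adj ^^ k) (C x)" for k x
    by (induction k) (simp_all add: C_shift)
  obtain b where b: "(shift_adj ^^ N) (C (e 0)) = scaleC b (e 0)"
    using funpow_shift_adj_multiple by blast
  have "scaleC 2 (C (e N)) = C ((shift ^^ N) (e 0))"
    using N by (simp add: funpow_shift_e0 scale)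
  also have "\<dots> = scaleC b (e 0)" by (simp add: C_funpow b)
  finally have "scaleC (1/2) (scaleC 2 (C (e N))) = scaleC (1/2) (scaleC b (e 0))" by simp
  then have CeN: "C (e N) = scaleC (b/2) (e 0)" by (simp add: scaleC_scaleC scaleC_one)
  then have "cmod (b/2) = 1"
    using iso[of "e N"] by (simp add: norm_scaleC norm_e)
  \<comment> \<open>The first weight 2 acts here, while the other evaluation below meets the last
    weight 1.\<close>
  then have "norm (shift (C (e N))) = 2"
    using N by (simp add: CeN bounded_clinearD(2)[OF bounded_clinear_shift] shift_e weight_def
        norm_scaleC norm_e)
  moreover have "norm (shift (C (e N))) = 1"
  proof -
    have "shift_adj (e N) = e (N - 1)"
      using N shift_adj_e[of "N - 1"] by (simp add: weight_def scaleC_one)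
    then show ?thesis by (simp add: shift_C iso norm_e)
  qed
  ultimately show False by simp
qed

end

theorem theorem3p2:
  assumes "separable_space (UNIV :: 'a::chilbert set)"
  shows "(\<forall>T :: 'a \<Rightarrow> 'a. bounded_clinear T \<and> algebraic_op T \<and> alg_degree T \<le> 2
            \<longrightarrow> complex_symmetric T)
       \<and> (\<forall>n::nat. n \<ge> 3 \<longrightarrow>
            (\<exists>S :: 'a set. finite S \<and> card S = n \<and> \<not> cdependent S) \<longrightarrow>
            (\<exists>T :: 'a \<Rightarrow> 'a. bounded_clinear T \<and> algebraic_op T \<and> alg_degree T = n
                  \<and> \<not> complex_symmetric T))"
proof (intro conjI allI impI)
  show "complex_symmetric T" if "bounded_clinear T \<and> algebraic_op T \<and> alg_degree T \<le> 2"
    for T :: "'a \<Rightarrow> 'a"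
    using that complex_symmetric_of_degree_le_2 by blast
next
  fix n :: nat
  assume n: "n \<ge> 3" and "\<exists>S :: 'a set. finite S \<and> card S = n \<and> \<not> cdependent S"
  then obtain S :: "'a set" where S: "finite S" "card S = n" "\<not> cdependent S" by blast
  obtain e :: "nat \<Rightarrow> 'a"
    where e: "\<And>i j. i < card S \<Longrightarrow> j < card S \<Longrightarrow> cinner (e i) (e j) = (if i = j then 1 else 0)"
    using orthonormal_family_exists[OF S(1,3)] by metis
  obtain N where n_eq: "n = Suc N" using n by (cases n) auto
  interpret weighted_shift e N
  proof
    show "N \<ge> 2" using n n_eq by simp
    show "cinner (e i) (e j) = (if i = j then 1 else 0)" if "i \<le> N" "j \<le> N" for i j
      using that by (intro e) (simp_all add: S(2) n_eq)
  qed
  show "\<exists>T :: 'a \<Rightarrow> 'a. bounded_clinear T \<and> algebraic_op T \<and> alg_degree T = n \<and> \<not> complex_symmetric T"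
    unfolding n_eq
    by (intro exI[of _ shift] conjI bounded_clinear_shift algebraic_op_shift alg_degree_shift
        not_complex_symmetric_shift)
qed

end
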